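(* Let $\beta$ be a quadratic unitary Pisot number, i.e. $\beta>1$ is a root of $x^2=mx+1$ for some integer $m\ge 1$, or of $x^2=mx-1$ for some integer $m\ge 4$, and let $s\in\mathbb{Z}[\beta]$. Say that the parameter $s$ is model-set-forcing if any uniformly discrete $s$-convex set $\Lambda\subset\mathbb{Z}[\beta]$ containing $0$ and $1$ is a model set in $\mathbb{Z}[\beta]$. Then the parameter $s$ is model-set-forcing if and only if $s$ or $1-s$ takes one of the three values $-\tfrac12(1+\sqrt5)$, $-1-\sqrt2$, or $2+\sqrt3$.
   Context: For $\beta$ as in the claim, $\beta'$ denotes the other root of the same quadratic equation, $\mathbb{Z}[\beta]=\mathbb{Z}+\mathbb{Z}\beta$, and the Galois conjugation on $\mathbb{Z}[\beta]$ is $x=a+b\beta\mapsto x'=a+b\beta'$ ($a,b\in\mathbb{Z}$). For a real parameter $s$, define $x\vdash_s y := sx+(1-s)y$. A set $\Lambda\subset\mathbb{R}$ is $s$-convex if it is closed under this operation, i.e. $x\vdash_s y\in\Lambda$ for all $x,y\in\Lambda$. A set $\Lambda\subset\mathbb{R}$ is uniformly discrete if there is $\varepsilon>0$ such that $|x-y|>\varepsilon$ for all distinct $x,y\in\Lambda$. A model set in $\mathbb{Z}[\beta]$ is a set of the form $\Sigma_\beta(\Omega)=\{x\in\mathbb{Z}[\beta] : x'\in\Omega\}$, where $\Omega$ is a bounded interval in $\mathbb{R}$.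
   Formalization: The equivalence is proved with "s is model-set-forcing" strengthened to also require that at least one uniformly discrete s-convex set in Z[β] containing 0 and 1 exists; otherwise e.g. β=1+√2, s=√2−1 is forcing vacuously though not listed. *)

theory Defs
  imports "HOL-Analysis.Analysis" "HOL-Computational_Algebra.Polynomial"
begin

definition quadratic_unitary_Pisot :: "real \<Rightarrow> bool" where
  "quadratic_unitary_Pisot \<beta> \<longleftrightarrow> \<beta> > 1 \<and>
     ((\<exists>m::int. m \<ge> 1 \<and> \<beta>\<^sup>2 = of_int m * \<beta> + 1) \<or>
      (\<exists>m::int. m \<ge> 4 \<and> \<beta>\<^sup>2 = of_int m * \<beta> - 1))"

text \<open>The other root of the quadratic equation of \<open>\<beta>\<close>; it is unique, see
  \<open>conj_root_plus\<close> and \<open>conj_root_minus\<close> below.\<close>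

definition conj_root :: "real \<Rightarrow> real" where
  "conj_root \<beta> = (THE \<gamma>. \<gamma> \<noteq> \<beta> \<and>
     ((\<exists>m::int. m \<ge> 1 \<and> \<beta>\<^sup>2 = of_int m * \<beta> + 1 \<and> \<gamma>\<^sup>2 = of_int m * \<gamma> + 1) \<or>
      (\<exists>m::int. m \<ge> 4 \<and> \<beta>\<^sup>2 = of_int m * \<beta> - 1 \<and> \<gamma>\<^sup>2 = of_int m * \<gamma> - 1)))"

definition Z_adj :: "real \<Rightarrow> real set" where
  "Z_adj \<beta> = {of_int a + of_int b * \<beta> | a b :: int. True}"

text \<open>Meaningful only on \<open>Z_adj \<beta>\<close>, where it is well defined because \<open>\<beta>\<close> is
  irrational (\<open>galois_conj_eq\<close> below).\<close>

definition galois_conj :: "real \<Rightarrow> real \<Rightarrow> real" where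
  "galois_conj \<beta> x =
     (THE y. \<exists>a b :: int. x = of_int a + of_int b * \<beta> \<and> y = of_int a + of_int b * conj_root \<beta>)"

definition s_comb :: "real \<Rightarrow> real \<Rightarrow> real \<Rightarrow> real" where
  "s_comb s x y = s * x + (1 - s) * y"

definition s_convex :: "real \<Rightarrow> real set \<Rightarrow> bool" where
  "s_convex s \<Lambda> \<longleftrightarrow> (\<forall>x\<in>\<Lambda>. \<forall>y\<in>\<Lambda>. s_comb s x y \<in> \<Lambda>)"

definition Sigma_set :: "real \<Rightarrow> real set \<Rightarrow> real set" where
  "Sigma_set \<beta> \<Omega> = {x \<in> Z_adj \<beta>. galois_conj \<beta> x \<in> \<Omega>}"

text \<open>The window may be open, closed or half-open.\<close>

definition model_set :: "real \<Rightarrow> real set \<Rightarrow> bool" where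
  "model_set \<beta> \<Lambda> \<longleftrightarrow> (\<exists>\<Omega>. is_interval \<Omega> \<and> bounded \<Omega> \<and> \<Lambda> = Sigma_set \<beta> \<Omega>)"

definition ud_s_convex :: "real \<Rightarrow> real \<Rightarrow> real set \<Rightarrow> bool" where
  "ud_s_convex \<beta> s \<Lambda> \<longleftrightarrow>
     \<Lambda> \<subseteq> Z_adj \<beta> \<and> 0 \<in> \<Lambda> \<and> 1 \<in> \<Lambda> \<and> uniform_discrete \<Lambda> \<and> s_convex s \<Lambda>"

definition model_set_forcing :: "real \<Rightarrow> real \<Rightarrow> bool" where
  "model_set_forcing \<beta> s \<longleftrightarrow> (\<forall>\<Lambda>. ud_s_convex \<beta> s \<Lambda> \<longrightarrow> model_set \<beta> \<Lambda>)"

lemma uniform_discrete_alt: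
  "uniform_discrete (\<Lambda> :: real set) \<longleftrightarrow>
     (\<exists>\<epsilon>>0. \<forall>x\<in>\<Lambda>. \<forall>y\<in>\<Lambda>. x \<noteq> y \<longrightarrow> \<bar>x - y\<bar> > \<epsilon>)"
proof
  assume "uniform_discrete \<Lambda>"
  then obtain e where e: "e > 0" "\<forall>x\<in>\<Lambda>. \<forall>y\<in>\<Lambda>. dist x y < e \<longrightarrow> x = y"
    unfolding uniform_discrete_def by blast
  then show "\<exists>\<epsilon>>0. \<forall>x\<in>\<Lambda>. \<forall>y\<in>\<Lambda>. x \<noteq> y \<longrightarrow> \<bar>x - y\<bar> > \<epsilon>"
    by (intro exI[of _ "e/2"]) (auto simp: dist_real_def, smt (verit) field_sum_of_halves)
next
  assume "\<exists>\<epsilon>>0. \<forall>x\<in>\<Lambda>. \<forall>y\<in>\<Lambda>. x \<noteq> y \<longrightarrow> \<bar>x - y\<bar> > \<epsilon>"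
  then show "uniform_discrete \<Lambda>"
    unfolding uniform_discrete_def dist_real_def by (metis less_asym)
qed

lemma quadratic_irrational:
  fixes \<beta> :: real and m c :: int
  assumes "\<beta> > 1" "\<beta>\<^sup>2 = of_int m * \<beta> + of_int c" "\<bar>c\<bar> = 1"
  shows "\<beta> \<notin> \<rat>"
proof
  assume "\<beta> \<in> \<rat>"
  let ?p = "[:- of_int c, - of_int m, 1:] :: real poly"
  have "algebraic_int \<beta>"
  proof (rule algebraic_int.intros)
    show "lead_coeff ?p = 1" by simp
    show "\<forall>i. coeff ?p i \<in> \<int>"
      by (auto simp: coeff_pCons split: nat.splits)
    show "poly ?p \<beta> = 0"
      using assms(2) by (simp add: power2_eq_square algebra_simps)
  qed
  with \<open>\<beta> \<in> \<rat>\<close> have "\<beta> \<in> \<int>"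
    using rational_algebraic_int_is_int by blast
  then obtain k where k: "\<beta> = of_int k" by (elim Ints_cases)
  have "real_of_int (k * (k - m)) = of_int c"
    using assms(2) k by (simp add: power2_eq_square algebra_simps)
  then have "k * (k - m) = c" by (simp only: of_int_eq_iff)
  then have "k dvd 1" using assms(3) by (metis dvd_abs_iff dvd_triv_left)
  with assms(1) k show False by simp
qed

lemma Pisot_irrational: "quadratic_unitary_Pisot \<beta> \<Longrightarrow> \<beta> \<notin> \<rat>"
  unfolding quadratic_unitary_Pisot_def
  using quadratic_irrational[of \<beta> _ 1] quadratic_irrational[of \<beta> _ "-1"] by auto

lemma int_comb_eq_iff:
  fixes \<beta> :: real and a b c d :: int
  assumes "\<beta> \<notin> \<rat>"
  shows "of_int a + of_int b * \<beta> = of_int c + of_int d * \<beta> \<longleftrightarrow> a = c \<and> b = d"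
proof
  assume eq: "of_int a + of_int b * \<beta> = of_int c + of_int d * \<beta>"
  have "b = d"
  proof (rule ccontr)
    assume "b \<noteq> d"
    then have "\<beta> = of_int (c - a) / of_int (b - d)"
      using eq by (simp add: field_simps)
    then have "\<beta> \<in> \<rat>" by (metis Rats_divide Rats_of_int)
    with assms show False by simp
  qed
  with eq show "a = c \<and> b = d" by simp
qed simp

lemma other_root:
  fixes \<beta> \<gamma> m c :: real
  assumes "\<beta>\<^sup>2 = m * \<beta> + c" "\<gamma>\<^sup>2 = m * \<gamma> + c" "\<gamma> \<noteq> \<beta>"
  shows "\<gamma> = m - \<beta>"
proof -
  have "(\<gamma> - \<beta>) * (\<gamma> + \<beta> - m) = 0"
    using assms by (simp add: power2_eq_square algebra_simps)
  with assms(3) show ?thesis by simp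
qed

lemma conj_root_aux:
  fixes \<beta> :: real and m c n d :: int
  assumes "\<beta> > 1" "\<beta>\<^sup>2 = of_int m * \<beta> + of_int c" "\<bar>c\<bar> = 1"
    "\<beta>\<^sup>2 = of_int n * \<beta> + of_int d"
  shows "n = m \<and> d = c" "of_int m - \<beta> \<noteq> \<beta>"
    "(of_int m - \<beta>)\<^sup>2 = of_int m * (of_int m - \<beta>) + of_int c"
proof -
  have irr: "\<beta> \<notin> \<rat>" using quadratic_irrational assms(1-3) by blast
  show "n = m \<and> d = c"
    using int_comb_eq_iff[OF irr, of d n c m] assms(2,4) by (simp add: add.commute)
  show "of_int m - \<beta> \<noteq> \<beta>"
    using int_comb_eq_iff[OF irr, of m 0 0 2] by auto
  show "(of_int m - \<beta>)\<^sup>2 = of_int m * (of_int m - \<beta>) + of_int c"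
    using assms(2) by (simp add: power2_eq_square algebra_simps)
qed

lemma conj_root_plus:
  assumes "\<beta> > 1" "m \<ge> 1" "\<beta>\<^sup>2 = of_int m * \<beta> + 1"
  shows "conj_root \<beta> = of_int m - \<beta>"
  unfolding conj_root_def
proof (rule the_equality, goal_cases)
  case 1
  show ?case
    using assms conj_root_aux(2,3)[of \<beta> m 1 m 1] by auto
next
  case (2 \<gamma>)
  have "\<gamma>\<^sup>2 = of_int m * \<gamma> + 1"
    using 2
  proof (elim conjE disjE exE)
    fix n :: int
    assume n: "\<beta>\<^sup>2 = of_int n * \<beta> + 1" "\<gamma>\<^sup>2 = of_int n * \<gamma> + 1"
    have "n = m" using conj_root_aux(1)[of \<beta> m 1 n 1] assms n(1) by simp
    with n(2) show ?thesis by simp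
  next
    fix n :: int
    assume n: "\<beta>\<^sup>2 = of_int n * \<beta> - 1"
    show ?thesis using conj_root_aux(1)[of \<beta> m 1 n "-1"] assms n by simp
  qed
  with 2 show ?case using other_root[of \<beta> "of_int m" 1 \<gamma>] assms(3) by simp
qed

lemma conj_root_minus:
  assumes "\<beta> > 1" "m \<ge> 4" "\<beta>\<^sup>2 = of_int m * \<beta> - 1"
  shows "conj_root \<beta> = of_int m - \<beta>"
  unfolding conj_root_def
proof (rule the_equality, goal_cases)
  case 1
  show ?case
    using assms conj_root_aux(2,3)[of \<beta> m "-1" m "-1"] by auto
next
  case (2 \<gamma>)
  have "\<gamma>\<^sup>2 = of_int m * \<gamma> - 1"
    using 2
  proof (elim conjE disjE exE)
    fix n :: int
    assume n: "\<beta>\<^sup>2 = of_int n * \<beta> - 1" "\<gamma>\<^sup>2 = of_int n * \<gamma> - 1"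
    have "n = m" using conj_root_aux(1)[of \<beta> m "-1" n "-1"] assms n(1) by simp
    with n(2) show ?thesis by simp
  next
    fix n :: int
    assume n: "\<beta>\<^sup>2 = of_int n * \<beta> + 1"
    show ?thesis using conj_root_aux(1)[of \<beta> m "-1" n 1] assms n by simp
  qed
  with 2 show ?case using other_root[of \<beta> "of_int m" "-1" \<gamma>] assms(3) by simp
qed

lemma galois_conj_eq:
  assumes "quadratic_unitary_Pisot \<beta>"
  shows "galois_conj \<beta> (of_int a + of_int b * \<beta>) = of_int a + of_int b * conj_root \<beta>"
  unfolding galois_conj_def
  by (rule the_equality) (auto simp: int_comb_eq_iff[OF Pisot_irrational[OF assms]])

text \<open>For some parameters no uniformly discrete \<open>s\<close>-convex subset of \<open>Z_adj \<beta>\<close>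
  contains 0 and 1, so that \<open>model_set_forcing \<beta> s\<close> holds vacuously:
  if \<open>0 < s < 1\<close>, such a set would contain all powers of \<open>s\<close>.
  Hence \<open>model_set_forcing\<close> has to be paired with the existence of at least one
  such set in order to single out the three exceptional values.\<close>

lemma no_ud_s_convex:
  assumes "0 < s" "s < 1"
  shows "\<not> ud_s_convex \<beta> s \<Lambda>"
proof
  assume A: "ud_s_convex \<beta> s \<Lambda>"
  have pow: "s ^ n \<in> \<Lambda>" for n
  proof (induction n)
    case (Suc n)
    then have "s_comb s (s ^ n) 0 \<in> \<Lambda>" using A unfolding ud_s_convex_def s_convex_def by blast
    then show ?case by (simp add: s_comb_def)
  qed (use A in \<open>simp add: ud_s_convex_def\<close>)
  obtain e where e: "e > 0" "\<forall>x\<in>\<Lambda>. \<forall>y\<in>\<Lambda>. dist x y < e \<longrightarrow> x = y"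
    using A unfolding ud_s_convex_def uniform_discrete_def by blast
  obtain n where "s ^ n < e" using real_arch_pow_inv[OF e(1) assms(2)] by blast
  moreover have "0 \<in> \<Lambda>" using A by (simp add: ud_s_convex_def)
  moreover have "dist (s ^ n) 0 = s ^ n" using assms by simp
  ultimately have "s ^ n = 0" using e(2) pow[of n] by metis
  with assms show False by simp
qed

lemma vacuous_forcing_example:
  "quadratic_unitary_Pisot (1 + sqrt 2)" "sqrt 2 - 1 \<in> Z_adj (1 + sqrt 2)"
  "model_set_forcing (1 + sqrt 2) (sqrt 2 - 1)"
proof -
  have "(1 + sqrt 2)\<^sup>2 = of_int 2 * (1 + sqrt 2) + 1"
    by (simp add: power2_eq_square algebra_simps)
  then show "quadratic_unitary_Pisot (1 + sqrt 2)"
    unfolding quadratic_unitary_Pisot_def by (intro conjI disjI1 exI[of _ 2]) auto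
  have "sqrt 2 - 1 = of_int (-2) + of_int 1 * (1 + sqrt 2)" by simp
  then show "sqrt 2 - 1 \<in> Z_adj (1 + sqrt 2)"
    unfolding Z_adj_def by blast
  have "sqrt 2 < 2" by (rule real_less_lsqrt) auto
  then show "model_set_forcing (1 + sqrt 2) (sqrt 2 - 1)"
    unfolding model_set_forcing_def using no_ud_s_convex[of "sqrt 2 - 1"] by simp
qed

end

theory Submission
  imports Defs
begin

text \<open>Write \<open>x'\<close> for the conjugate of \<open>x\<close> and \<open>\<Sigma>(I)\<close> for the model set with window \<open>I\<close>.

  Necessity: a model set that is \<open>s\<close>-convex and contains 0 and 1 contains all powers of \<open>s\<close> and
  of \<open>1 - s\<close>, so a bounded window forces \<open>0 \<le> s' \<le> 1\<close>, and finite sets exclude equality. The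
  part of \<open>\<Sigma>([0,1])\<close> that is congruent to 0 or 1 modulo \<open>s\<close> is then uniformly discrete and
  \<open>s\<close>-convex; it is a model set only if 0 and 1 represent all residue classes, that is, if the
  norm of \<open>s\<close> is at most 2 in absolute value. The same holds for \<open>1 - s\<close>. This leaves four
  quadratic equations for \<open>s > 1\<close>, one of which has discriminant 17 and does not occur
  because 17 is not of the form \<open>b\<^sup>2 (m\<^sup>2 \<plusminus> 4)\<close>.

  Sufficiency: each of the three values is a unit \<open>s\<close> such that 0 and 1 represent all residue
  classes modulo \<open>1 - s\<close>. Hence every \<open>x \<in> \<Sigma>([0,1])\<close> is an \<open>s\<close>-combination of some
  \<open>y \<in> \<Sigma>([0,1])\<close> with 0 or 1, where \<open>y\<close> is closer to 1/2 than \<open>x\<close> unless \<open>x\<close> is one of the few small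
  elements \<open>0, 1, s, 1 - s\<close>; by descent every \<open>s\<close>-convex set containing 0 and 1
  contains \<open>\<Sigma>([0,1])\<close>. Since \<open>s\<close> is a unit, combining with a further element \<open>b\<close> of the
  set enlarges this strip to \<open>\<Sigma>([0,b'])\<close>, so the set is the model set over the hull of its
  conjugates. A long strip contains small elements, so uniform discreteness bounds the window.\<close>

section \<open>Squares, reflection and affine maps\<close>

text \<open>Serves to exclude that small integers arising from discriminants, such as 7, 13 or 21,
  are squares.\<close>

lemma small_squares:
  fixes n :: int
  shows "n\<^sup>2 \<in> {0, 1, 4, 9, 16} \<or> 25 \<le> n\<^sup>2"
proof (cases "\<bar>n\<bar> < 5")
  case True
  then have "n \<in> {-4, -3, -2, -1, 0, 1, 2, 3, 4}" by auto
  then show ?thesis by auto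
next
  case False
  then have "5\<^sup>2 \<le> \<bar>n\<bar>\<^sup>2" by (intro power_mono) auto
  then show ?thesis by simp
qed

lemma s_comb_swap: "s_comb (1 - s) x y = s_comb s y x"
  by (simp add: s_comb_def)

lemma s_convex_swap: "s_convex (1 - s) \<Lambda> \<longleftrightarrow> s_convex s \<Lambda>"
  by (auto simp: s_convex_def s_comb_swap)

lemma ud_s_convex_swap: "ud_s_convex \<beta> (1 - s) \<Lambda> \<longleftrightarrow> ud_s_convex \<beta> s \<Lambda>"
  by (simp add: ud_s_convex_def s_convex_swap)

lemma model_set_forcing_swap: "model_set_forcing \<beta> (1 - s) \<longleftrightarrow> model_set_forcing \<beta> s"
  by (simp add: model_set_forcing_def ud_s_convex_swap)

lemma s_convexD:
  "s_convex s \<Lambda> \<Longrightarrow> x \<in> \<Lambda> \<Longrightarrow> y \<in> \<Lambda> \<Longrightarrow> s * x + (1 - s) * y \<in> \<Lambda>"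
  by (simp add: s_convex_def s_comb_def)

text \<open>The reflection in 1/2 is affine and exchanges 0 and 1, so facts about the upper end of a
  set carry over to its lower end.\<close>

lemma s_convex_reflect:
  assumes "s_convex s \<Lambda>"
  shows "s_convex s {x. 1 - x \<in> \<Lambda>}"
  unfolding s_convex_def s_comb_def
proof (clarify)
  fix x y
  assume "1 - x \<in> \<Lambda>" "1 - y \<in> \<Lambda>"
  from s_convexD[OF assms this] show "1 - (s * x + (1 - s) * y) \<in> \<Lambda>"
    by (simp add: algebra_simps)
qed

text \<open>The affine map taking \<open>y\<close> to \<open>x\<close> fixes \<open>e\<close>, and
  its inverse has slope at most \<open>r\<close> in absolute value. As \<open>e\<close> is at
  distance 1/2 from 1/2, the triangle inequality, used twice, gives the bound.\<close>

lemma affine_preimage_contraction: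
  fixes x y q e r :: real
  assumes "x = q * y + (1 - q) * e" "e = 0 \<or> e = 1" "1 \<le> r * \<bar>q\<bar>" "0 \<le> r"
  shows "\<bar>y - 1/2\<bar> \<le> r * \<bar>x - 1/2\<bar> + (1 + r) / 2"
proof -
  have q: "\<bar>q\<bar> > 0" using assms(3) by (cases "q = 0") auto
  have "q * (y - 1/2) = (x - 1/2) + (1 - q) / 2 \<or> q * (y - 1/2) = (x - 1/2) - (1 - q) / 2"
    using assms(1,2) by (auto simp: algebra_simps diff_divide_distrib)
  then have "\<bar>q * (y - 1/2)\<bar> \<le> \<bar>x - 1/2\<bar> + \<bar>(1 - q) / 2\<bar>"
    by (elim disjE) (simp_all only: abs_triangle_ineq abs_triangle_ineq4)
  also have "\<bar>(1 - q) / 2\<bar> \<le> (1 + \<bar>q\<bar>) / 2" by simp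
  finally have "\<bar>q * (y - 1/2)\<bar> \<le> \<bar>x - 1/2\<bar> + (1 + \<bar>q\<bar>) / 2" by simp
  then have "\<bar>q\<bar> * \<bar>y - 1/2\<bar> \<le> 1 * (\<bar>x - 1/2\<bar> + 1/2) + \<bar>q\<bar> / 2"
    by (simp add: abs_mult add_divide_distrib)
  also have "\<dots> \<le> (r * \<bar>q\<bar>) * (\<bar>x - 1/2\<bar> + 1/2) + \<bar>q\<bar> / 2"
    using assms(3) by (intro add_right_mono mult_right_mono) auto
  also have "\<dots> = \<bar>q\<bar> * (r * \<bar>x - 1/2\<bar> + (1 + r) / 2)"
    by (simp add: algebra_simps add_divide_distrib)
  finally show ?thesis using q by simp
qed

locale quadratic_Pisot =
  fixes \<beta> :: real
  assumes Pisot: "quadratic_unitary_Pisot \<beta>"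
begin

abbreviation Z :: "real set" where "Z \<equiv> Z_adj \<beta>"

abbreviation cj :: "real \<Rightarrow> real" where "cj \<equiv> galois_conj \<beta>"

subsection \<open>Conjugation in the quadratic order\<close>

lemma beta_gt_1: "\<beta> > 1"
  using Pisot by (simp add: quadratic_unitary_Pisot_def)

lemma equation:
  obtains m c :: int where "\<beta>\<^sup>2 = of_int m * \<beta> + of_int c" "\<bar>c\<bar> = 1"
    "conj_root \<beta> = of_int m - \<beta>"
proof -
  from Pisot consider
      m :: int where "m \<ge> 1" "\<beta>\<^sup>2 = of_int m * \<beta> + 1"
    | m :: int where "m \<ge> 4" "\<beta>\<^sup>2 = of_int m * \<beta> - 1"
    unfolding quadratic_unitary_Pisot_def by blast
  then show thesis
  proof cases
    case (1 m)
    with that[of m 1] conj_root_plus[OF beta_gt_1 1] show thesis by simp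
  next
    case (2 m)
    with that[of m "-1"] conj_root_minus[OF beta_gt_1 2] show thesis by simp
  qed
qed

lemma Z_cases:
  assumes "x \<in> Z"
  obtains a b :: int where "x = of_int a + of_int b * \<beta>"
    "cj x = of_int a + of_int b * conj_root \<beta>"
  using assms galois_conj_eq[OF Pisot] unfolding Z_adj_def by blast

lemma Z_I: "of_int a + of_int b * \<beta> \<in> Z"
  unfolding Z_adj_def by blast

lemma of_int_Z [simp]: "of_int a \<in> Z" and cj_of_int [simp]: "cj (of_int a) = of_int a"
  using Z_I[of a 0] galois_conj_eq[OF Pisot, of a 0] by simp_all

lemma zero_one_Z [simp]: "0 \<in> Z" "1 \<in> Z" "cj 0 = 0" "cj 1 = 1"
  using of_int_Z[of 0] of_int_Z[of 1] cj_of_int[of 0] cj_of_int[of 1] by simp_all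

lemma numeral_Z [simp]: "numeral k \<in> Z" "cj (numeral k) = numeral k"
  using of_int_Z[of "numeral k"] cj_of_int[of "numeral k"] by simp_all

lemma beta_Z [simp]: "\<beta> \<in> Z" and cj_beta: "cj \<beta> = conj_root \<beta>"
  using Z_I[of 0 1] galois_conj_eq[OF Pisot, of 0 1] by simp_all

lemma
  assumes "x \<in> Z" "y \<in> Z"
  shows add_Z [simp]: "x + y \<in> Z" and cj_add [simp]: "cj (x + y) = cj x + cj y"
proof -
  from assms obtain a b c d :: int where *:
    "x = of_int a + of_int b * \<beta>" "cj x = of_int a + of_int b * conj_root \<beta>"
    "y = of_int c + of_int d * \<beta>" "cj y = of_int c + of_int d * conj_root \<beta>"
    by (metis Z_cases)
  have "x + y = of_int (a + c) + of_int (b + d) * \<beta>"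
    using * by (simp add: algebra_simps)
  then show "x + y \<in> Z" "cj (x + y) = cj x + cj y"
    using * by (simp_all only: Z_I galois_conj_eq[OF Pisot]) (simp add: algebra_simps)
qed

lemma
  assumes "x \<in> Z" "y \<in> Z"
  shows diff_Z [simp]: "x - y \<in> Z" and cj_diff [simp]: "cj (x - y) = cj x - cj y"
proof -
  from assms obtain a b c d :: int where *:
    "x = of_int a + of_int b * \<beta>" "cj x = of_int a + of_int b * conj_root \<beta>"
    "y = of_int c + of_int d * \<beta>" "cj y = of_int c + of_int d * conj_root \<beta>"
    by (metis Z_cases)
  have "x - y = of_int (a - c) + of_int (b - d) * \<beta>"
    using * by (simp add: algebra_simps)
  then show "x - y \<in> Z" "cj (x - y) = cj x - cj y"
    using * by (simp_all only: Z_I galois_conj_eq[OF Pisot]) (simp add: algebra_simps)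
qed

lemma
  assumes "x \<in> Z" "y \<in> Z"
  shows mult_Z [simp]: "x * y \<in> Z" and cj_mult [simp]: "cj (x * y) = cj x * cj y"
proof -
  obtain m e :: int where me: "\<beta>\<^sup>2 = of_int m * \<beta> + of_int e"
    "conj_root \<beta> = of_int m - \<beta>" by (metis equation)
  from assms obtain a b c d :: int where *:
    "x = of_int a + of_int b * \<beta>" "cj x = of_int a + of_int b * conj_root \<beta>"
    "y = of_int c + of_int d * \<beta>" "cj y = of_int c + of_int d * conj_root \<beta>"
    by (metis Z_cases)
  have "x * y = of_int (a * c) + of_int (a * d + b * c) * \<beta> + of_int (b * d) * \<beta>\<^sup>2"
    using * by (simp add: algebra_simps power2_eq_square)
  also have "\<dots> = of_int (a * c + b * d * e) + of_int (a * d + b * c + b * d * m) * \<beta>"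
    using me(1) by (simp add: algebra_simps)
  finally have xy: "x * y = of_int (a * c + b * d * e) + of_int (a * d + b * c + b * d * m) * \<beta>" .
  then show "x * y \<in> Z" by (simp only: Z_I)
  have "(conj_root \<beta>)\<^sup>2 = of_int m * conj_root \<beta> + of_int e"
    unfolding me(2) using me(1) by (simp add: algebra_simps power2_eq_square)
  moreover have "cj x * cj y = of_int (a * c) + of_int (a * d + b * c) * conj_root \<beta>
      + of_int (b * d) * (conj_root \<beta>)\<^sup>2"
    unfolding *(2,4) by (simp add: algebra_simps power2_eq_square)
  ultimately have "cj x * cj y =
      of_int (a * c) + of_int (a * d + b * c) * conj_root \<beta>
        + of_int (b * d) * (of_int m * conj_root \<beta> + of_int e)"
    by simp
  then show "cj (x * y) = cj x * cj y"
    unfolding xy galois_conj_eq[OF Pisot] by (simp add: algebra_simps)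
qed

lemma
  assumes "x \<in> Z"
  shows power_Z [simp]: "x ^ n \<in> Z" and cj_power [simp]: "cj (x ^ n) = cj x ^ n"
proof -
  have "x ^ n \<in> Z \<and> cj (x ^ n) = cj x ^ n"
    using assms by (induction n) auto
  then show "x ^ n \<in> Z" "cj (x ^ n) = cj x ^ n" by auto
qed

lemma
  assumes "x \<in> Z"
  shows cj_Z [simp]: "cj x \<in> Z" and cj_cj [simp]: "cj (cj x) = x"
proof -
  obtain m where m: "conj_root \<beta> = of_int m - \<beta>" by (metis equation)
  have *: "conj_root \<beta> \<in> Z" "cj (conj_root \<beta>) = \<beta>"
    by (simp_all add: m cj_beta)
  from assms obtain a b :: int where
    x: "x = of_int a + of_int b * \<beta>" and cjx: "cj x = of_int a + of_int b * conj_root \<beta>"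
    by (rule Z_cases)
  show "cj x \<in> Z" "cj (cj x) = x" unfolding cjx using * x by simp_all
qed

lemma cj_eq_0_iff [simp]: "x \<in> Z \<Longrightarrow> cj x = 0 \<longleftrightarrow> x = 0"
  by (metis cj_cj zero_one_Z(3))

lemma cj_eq_iff: "x \<in> Z \<Longrightarrow> y \<in> Z \<Longrightarrow> cj x = cj y \<longleftrightarrow> x = y"
  by (metis cj_cj)

lemma trace_Ints: "x \<in> Z \<Longrightarrow> x + cj x \<in> \<int>"
proof (erule Z_cases)
  fix a b :: int
  assume *: "x = of_int a + of_int b * \<beta>" "cj x = of_int a + of_int b * conj_root \<beta>"
  obtain m where m: "conj_root \<beta> = of_int m - \<beta>" by (metis equation)
  have "x + cj x = of_int (2 * a + b * m)"
    unfolding *(2) unfolding *(1) m by (simp add: algebra_simps)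
  then show ?thesis by (metis Ints_of_int)
qed

lemma norm_Ints: "x \<in> Z \<Longrightarrow> x * cj x \<in> \<int>"
proof (erule Z_cases)
  fix a b :: int
  assume *: "x = of_int a + of_int b * \<beta>" "cj x = of_int a + of_int b * conj_root \<beta>"
  obtain m e :: int where me: "\<beta>\<^sup>2 = of_int m * \<beta> + of_int e"
    "conj_root \<beta> = of_int m - \<beta>" by (metis equation)
  have "x * cj x = of_int (a * a + a * b * m) + of_int (b * b) * (of_int m * \<beta> - \<beta>\<^sup>2)"
    unfolding *(2) unfolding *(1) me(2) by (simp add: algebra_simps power2_eq_square)
  also have "\<dots> = of_int (a * a + a * b * m - b * b * e)"
    by (simp add: me(1))
  finally show ?thesis by (metis Ints_of_int)
qed

text \<open>The norm is a nonzero integer: a nonzero element and its conjugate cannot both be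
  small.\<close>

lemma norm_ge_1: "x \<in> Z \<Longrightarrow> x \<noteq> 0 \<Longrightarrow> \<bar>x * cj x\<bar> \<ge> 1"
  using norm_Ints[of x] Ints_nonzero_abs_ge1[of "x * cj x"] by simp

lemma unit_inverse:
  assumes "x \<in> Z" "\<bar>x * cj x\<bar> = 1"
  obtains u where "u \<in> Z" "x * u = 1"
proof -
  have "x * ((x * cj x) * cj x) = (x * cj x)\<^sup>2" by (simp add: power2_eq_square)
  also have "\<dots> = 1" using assms(2) by (metis one_power2 power2_abs)
  finally show thesis
    using that[of "x * cj x * cj x"] assms(1) by simp
qed

lemma norm_beta: "\<bar>\<beta> * cj \<beta>\<bar> = 1"
proof -
  obtain m e :: int where me: "\<beta>\<^sup>2 = of_int m * \<beta> + of_int e" "\<bar>e\<bar> = 1"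
    "conj_root \<beta> = of_int m - \<beta>" by (rule equation)
  have "\<beta> * cj \<beta> = - of_int e"
    unfolding cj_beta me(3) using me(1) by (simp add: algebra_simps power2_eq_square)
  with me(2) show ?thesis by (metis abs_minus_cancel of_int_1 of_int_abs)
qed

section \<open>Small elements and the unit strip\<close>

text \<open>Even powers of \<beta> work: \<open>cj \<beta>\<close> has absolute value 1/\<beta> < 1,
  and squaring makes the conjugate positive.\<close>

lemma small_conjugate:
  assumes "e > 0"
  obtains w where "w \<in> Z" "0 < w" "0 < cj w" "cj w < e"
proof -
  have "\<beta> * \<bar>cj \<beta>\<bar> = 1"
    using norm_beta beta_gt_1 by (simp add: abs_mult)
  then have "\<bar>cj \<beta>\<bar> = 1 / \<beta>" using beta_gt_1 by (simp add: field_simps)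
  then have b: "0 < \<bar>cj \<beta>\<bar>" "\<bar>cj \<beta>\<bar> < 1" using beta_gt_1 by simp_all
  then have "0 < (cj \<beta>)\<^sup>2" "(cj \<beta>)\<^sup>2 < 1"
    by (simp_all add: abs_square_less_1)
  moreover from this obtain n where "((cj \<beta>)\<^sup>2) ^ n < e"
    using real_arch_pow_inv[OF assms] by blast
  ultimately show thesis
    using that[of "(\<beta>\<^sup>2) ^ n"] beta_gt_1 by simp
qed

lemma small_element:
  assumes "e > 0"
  obtains w where "w \<in> Z" "0 < w" "w < e" "0 < cj w"
  using small_conjugate[OF assms] that cj_Z cj_cj by metis

lemma mem_Sigma [simp]: "x \<in> Sigma_set \<beta> \<Omega> \<longleftrightarrow> x \<in> Z \<and> cj x \<in> \<Omega>"
  by (simp add: Sigma_set_def)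

text \<open>Conjugates of two elements differ by at most 1, so a nonzero difference, whose norm is
  at least 1 in absolute value, is itself at least 1 in absolute value.\<close>

lemma uniform_discrete_unit_strip:
  assumes "\<Lambda> \<subseteq> Sigma_set \<beta> {0..1}"
  shows "uniform_discrete \<Lambda>"
  unfolding uniform_discrete_def
proof (intro exI[of _ 1] conjI ballI impI)
  fix x y
  assume "x \<in> \<Lambda>" "y \<in> \<Lambda>" and d: "dist x y < 1"
  with assms have *: "x \<in> Z" "y \<in> Z" "cj x \<in> {0..1}" "cj y \<in> {0..1}" by auto
  show "x = y"
  proof (rule ccontr)
    assume "x \<noteq> y"
    then have "1 \<le> \<bar>x - y\<bar> * \<bar>cj (x - y)\<bar>"
      using * norm_ge_1[of "x - y"] by (simp add: abs_mult)
    also have "\<dots> \<le> \<bar>x - y\<bar> * 1"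
      using * by (intro mult_left_mono) auto
    finally show False using d by (simp add: dist_real_def)
  qed
qed simp

text \<open>On conjugates the operation is a true convex combination, with positive weights
  \<open>cj s\<close> and \<open>1 - cj s\<close>.\<close>

lemma unit_strip_ud_s_convex:
  assumes "s \<in> Z" "0 < cj s" "cj s < 1"
  shows "ud_s_convex \<beta> s (Sigma_set \<beta> {0..1})"
  unfolding ud_s_convex_def s_convex_def s_comb_def
proof (intro conjI ballI)
  fix x y
  assume "x \<in> Sigma_set \<beta> {0..1}" "y \<in> Sigma_set \<beta> {0..1}"
  with assms show "s * x + (1 - s) * y \<in> Sigma_set \<beta> {0..1}"
    using convex_bound_le[of "cj x" 1 "cj y" "cj s" "1 - cj s"] by simp
qed (auto simp: uniform_discrete_unit_strip)

subsection \<open>Forcing parameters\<close>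

text \<open>Repeated combination with 0 yields all powers of \<open>s\<close>, whose conjugates are
  unbounded if \<open>cj s > 1\<close>.\<close>

lemma model_set_cj_le_1:
  assumes "s \<in> Z" "s_convex s \<Lambda>" "0 \<in> \<Lambda>" "1 \<in> \<Lambda>" "model_set \<beta> \<Lambda>"
  shows "cj s \<le> 1"
proof (rule ccontr)
  assume "\<not> cj s \<le> 1"
  from assms(5) obtain \<Omega> where "bounded \<Omega>" and \<Lambda>: "\<Lambda> = Sigma_set \<beta> \<Omega>"
    unfolding model_set_def by blast
  then obtain B where B: "\<And>x. x \<in> \<Omega> \<Longrightarrow> \<bar>x\<bar> \<le> B"
    unfolding bounded_iff by auto
  have "s ^ n \<in> \<Lambda>" for n
  proof (induction n)
    case (Suc n)
    from s_convexD[OF assms(2) this assms(3)] show ?case by simp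
  qed (use assms in simp)
  then have "\<bar>cj s ^ n\<bar> \<le> B" for n
    using \<Lambda> B assms(1) by fastforce
  moreover obtain n where "B < cj s ^ n"
    using real_arch_pow \<open>\<not> cj s \<le> 1\<close> by (meson not_le)
  ultimately show False by (meson abs_le_D1 not_le)
qed

lemma forcing_cj_in_unit_interval:
  assumes "s \<in> Z" "ud_s_convex \<beta> s \<Lambda>" "model_set_forcing \<beta> s"
  shows "0 < cj s" "cj s < 1"
proof -
  have le: "cj t \<le> 1" if "t = s \<or> t = 1 - s" for t
    using that assms model_set_cj_le_1[of t \<Lambda>]
    unfolding ud_s_convex_def model_set_forcing_def by (auto simp: s_convex_swap)
  \<comment> \<open>For \<open>s = 0\<close> or \<open>s = 1\<close> the set \<open>{0, 1}\<close>
    is closed under the operation, but a window containing 0 and 1 also contains the conjugate of a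
    further element.\<close>
  have ne: "t \<noteq> 0" if "t = s \<or> t = 1 - s" for t
  proof
    assume "t = 0"
    then have "s = 0 \<or> s = 1" using that by auto
    then have "ud_s_convex \<beta> s {0, 1}"
      by (auto simp: ud_s_convex_def s_convex_def s_comb_def intro: uniform_discrete_unit_strip)
    then obtain \<Omega> where \<Omega>: "is_interval \<Omega>" "{0, 1} = Sigma_set \<beta> \<Omega>"
      using assms(3) unfolding model_set_forcing_def model_set_def by blast
    then have "0 \<in> \<Omega>" "1 \<in> \<Omega>" using zero_one_Z by (metis insertCI mem_Sigma)+
    obtain w where w: "w \<in> Z" "0 < cj w" "cj w < 1"
      using small_conjugate[of 1] by auto
    with \<open>0 \<in> \<Omega>\<close> \<open>1 \<in> \<Omega>\<close> \<Omega>(1) have "cj w \<in> \<Omega>"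
      unfolding is_interval_1 by (meson less_imp_le)
    with w(1) \<Omega>(2) have "w \<in> {0, 1}" by simp
    with w show False by auto
  qed
  show "0 < cj s" using le[of "1 - s"] ne[of s] assms(1) by (simp add: order_less_le)
  show "cj s < 1"
    using le[of s] ne[of "1 - s"] assms(1) cj_eq_iff[of s 1] by (simp add: order_less_le)
qed

text \<open>Every residue class modulo \<open>s\<close> meets the strip, so comparing the strip with its
  part congruent to 0 or 1 modulo \<open>s\<close> leaves at most two classes.\<close>

lemma forcing_residues:
  assumes s: "s \<in> Z" "0 < cj s" "cj s < 1" "model_set_forcing \<beta> s" and z: "z \<in> Z"
  obtains u where "u \<in> Z" "z = s * u \<or> z = 1 + s * u"
proof -
  define \<Lambda> where
    "\<Lambda> = {x \<in> Sigma_set \<beta> {0..1}. \<exists>u\<in>Z. x = s * u \<or> x = 1 + s * u}"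
  have "ud_s_convex \<beta> s \<Lambda>"
    unfolding ud_s_convex_def
  proof (intro conjI)
    show "\<Lambda> \<subseteq> Z" "0 \<in> \<Lambda>" "1 \<in> \<Lambda>"
      by (auto simp: \<Lambda>_def intro: bexI[of _ 0])
    show "uniform_discrete \<Lambda>"
      by (rule uniform_discrete_unit_strip) (auto simp: \<Lambda>_def)
    have strip: "s_convex s (Sigma_set \<beta> {0..1})"
      using unit_strip_ud_s_convex[OF s(1-3)] by (simp add: ud_s_convex_def)
    show "s_convex s \<Lambda>"
      unfolding s_convex_def s_comb_def
    proof (intro ballI)
      fix x y
      assume x: "x \<in> \<Lambda>" and y: "y \<in> \<Lambda>"
      then obtain u where u: "u \<in> Z" "y = s * u \<or> y = 1 + s * u"
        unfolding \<Lambda>_def by blast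
      have "x \<in> Z" "y \<in> Z" using x y by (auto simp: \<Lambda>_def)
      \<comment> \<open>Modulo \<open>s\<close> the combination is congruent to \<open>y\<close>, so
        it stays in the two classes.\<close>
      then have "u + (x - y) \<in> Z" using u by simp
      moreover have "s * x + (1 - s) * y = s * (u + (x - y)) \<or>
          s * x + (1 - s) * y = 1 + s * (u + (x - y))"
        using u(2) by (auto simp: algebra_simps)
      moreover have "s * x + (1 - s) * y \<in> Sigma_set \<beta> {0..1}"
        using s_convexD[OF strip] x y unfolding \<Lambda>_def by blast
      ultimately show "s * x + (1 - s) * y \<in> \<Lambda>" unfolding \<Lambda>_def by blast
    qed
  qed
  then obtain \<Omega> where \<Omega>: "is_interval \<Omega>" "\<Lambda> = Sigma_set \<beta> \<Omega>" and "0 \<in> \<Lambda>" "1 \<in> \<Lambda>"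
    using s(4) unfolding model_set_forcing_def model_set_def ud_s_convex_def by blast
  then have "0 \<in> \<Omega>" "1 \<in> \<Omega>" by (simp_all only: \<Omega>(2) mem_Sigma zero_one_Z)
  \<comment> \<open>The norm is a multiple of \<open>s\<close> fixed by conjugation. Subtracting
    multiples of \<open>N * w\<close> from \<open>z\<close> keeps its class modulo \<open>s\<close>
    and moves its conjugate in steps of \<open>d < 1\<close>.\<close>
  define N where "N = s * cj s"
  have "s \<noteq> 0" using s(2) by auto
  then have "N \<noteq> 0" using s by (simp add: N_def)
  then obtain w where w: "w \<in> Z" "0 < cj w" "cj w < 1 / \<bar>N\<bar>"
    using small_conjugate[of "1 / \<bar>N\<bar>"] by auto
  have NZ: "N \<in> Z" "cj N = N" using s(1) by (simp_all add: N_def)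
  define d where "d = \<bar>N\<bar> * cj w"
  have d: "0 < d" "d < 1" using w \<open>N \<noteq> 0\<close> by (simp_all add: d_def field_simps)
  define k where "k = \<lfloor>cj z / d\<rfloor>"
  define j where "j = (if N > 0 then k else - k)"
  have jk: "of_int j * N = of_int k * \<bar>N\<bar>" by (auto simp: j_def)
  define x where "x = z - of_int j * N * w"
  have xZ: "x \<in> Z" using z NZ w by (simp add: x_def)
  have "cj x = cj z - of_int j * N * cj w"
    using z NZ w by (simp add: x_def)
  then have cjx: "cj x = cj z - of_int k * d"
    unfolding jk by (simp add: d_def mult.assoc)
  have "of_int k \<le> cj z / d" "cj z / d < of_int k + 1"
    unfolding k_def by linarith+
  then have "of_int k * d \<le> cj z" "cj z < (of_int k + 1) * d"
    using d by (simp_all add: field_simps)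
  then have "0 \<le> cj x" "cj x \<le> 1" using cjx d by (simp_all add: algebra_simps)
  then have "cj x \<in> \<Omega>"
    using \<Omega>(1) \<open>0 \<in> \<Omega>\<close> \<open>1 \<in> \<Omega>\<close> unfolding is_interval_1 by blast
  then have "x \<in> \<Lambda>" using xZ \<Omega>(2) by simp
  then obtain u where u: "u \<in> Z" "x = s * u \<or> x = 1 + s * u"
    unfolding \<Lambda>_def by blast
  have "u + of_int j * cj s * w \<in> Z" using u w s by simp
  moreover have "z = s * (u + of_int j * cj s * w) \<or> z = 1 + s * (u + of_int j * cj s * w)"
    using u(2) by (auto simp: x_def N_def algebra_simps)
  ultimately show thesis using that by blast
qed

section \<open>Norms, discriminants and the four candidates\<close>

text \<open>The residue class of 2 shows that \<open>s\<close> divides 1 or 2, so its norm divides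
  4. If the norm is \<plusminus>4, then \<open>s\<close> is 2 times a unit, but \<beta> is congruent
  to neither 0 nor 1 modulo 2.\<close>

lemma forcing_norm:
  assumes s: "s \<in> Z" "0 < cj s" "cj s < 1" "model_set_forcing \<beta> s"
  shows "\<bar>s * cj s\<bar> = 1 \<or> \<bar>s * cj s\<bar> = 2"
proof -
  have norm: "\<exists>n. \<bar>x * cj x\<bar> = of_int n" if "x \<in> Z" for x
    using norm_Ints[OF that] by (metis Ints_cases of_int_abs)
  obtain n where n: "\<bar>s * cj s\<bar> = of_int n" using norm s(1) by blast
  have "2 \<in> Z" by simp
  from forcing_residues[OF s this]
  obtain u where u: "u \<in> Z" "2 = s * u \<or> 2 = 1 + s * u" by blast
  obtain k where k: "\<bar>u * cj u\<bar> = of_int k" using norm u(1) by blast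
  have nk: "n \<ge> 0" "k \<ge> 0" using n k by (metis abs_ge_zero of_int_0_le_iff)+
  have cjsu: "cj (s * u) = cj s * cj u" using s u by simp
  have prod: "\<bar>s * cj s\<bar> * \<bar>u * cj u\<bar> = \<bar>(s * u) * cj (s * u)\<bar>"
    unfolding cjsu by (simp add: abs_mult)
  show ?thesis
  proof (cases "s * u = 1")
    case True
    then have "of_int n * of_int k = (1 :: real)" using prod n k by simp
    then have "n * k = 1" by (metis of_int_eq_1_iff of_int_mult)
    then have "n = 1" using nk by (simp add: zmult_eq_1_iff)
    then show ?thesis using n by simp
  next
    case False
    then have su: "s * u = 2" using u(2) by auto
    then have "of_int n * of_int k = (4 :: real)" using prod n k su by simp
    then have nk4: "n * k = 4" by (metis of_int_eq_numeral_iff of_int_mult)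
    then have "n dvd 4" by (metis dvd_triv_left)
    then have "n \<le> 4" by (rule zdvd_imp_le) simp
    then have "n = 0 \<or> n = 1 \<or> n = 2 \<or> n = 3 \<or> n = 4" using nk by auto
    moreover have "n \<noteq> 0" using nk4 by auto
    moreover have "n \<noteq> 3" using nk4 by (cases "n = 3") (simp, presburger, simp)
    moreover have "n \<noteq> 4"
    proof
      assume "n = 4"
      then have "\<bar>u * cj u\<bar> = 1" using nk4 k by simp
      then obtain v where v: "v \<in> Z" "u * v = 1" using unit_inverse u(1) by blast
      have s2: "s = 2 * v" using su v(2) by (metis mult.assoc mult.right_neutral)
      obtain t where t: "t \<in> Z" "\<beta> = s * t \<or> \<beta> = 1 + s * t"
        using forcing_residues[OF s beta_Z] by blast
      have "v * t \<in> Z" using v(1) t(1) by simp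
      then obtain a b :: int where ab: "v * t = of_int a + of_int b * \<beta>"
        unfolding Z_adj_def by blast
      have "of_int 0 + of_int 1 * \<beta> = of_int (2 * a) + of_int (2 * b) * \<beta> \<or>
        of_int 0 + of_int 1 * \<beta> = of_int (1 + 2 * a) + of_int (2 * b) * \<beta>"
        using t(2) ab by (auto simp: s2 mult.assoc)
      then have "1 = 2 * b"
        unfolding int_comb_eq_iff[OF Pisot_irrational[OF Pisot]] by blast
      then show False by presburger
    qed
    ultimately show ?thesis using n by auto
  qed
qed

text \<open>The difference \<open>x - cj x\<close> is \<open>b\<close> times that of \<beta>, whose
  square is the discriminant of the equation of \<beta>.\<close>

lemma discriminant:
  assumes "x \<in> Z"
  obtains a b m c :: int where "x = of_int a + of_int b * \<beta>" "\<bar>c\<bar> = 1"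
    "(x - cj x)\<^sup>2 = of_int (b\<^sup>2 * (m\<^sup>2 + 4 * c))"
proof -
  obtain m c :: int where me: "\<beta>\<^sup>2 = of_int m * \<beta> + of_int c" "\<bar>c\<bar> = 1"
    "conj_root \<beta> = of_int m - \<beta>" by (rule equation)
  from assms obtain a b :: int where ab: "x = of_int a + of_int b * \<beta>"
    "cj x = of_int a + of_int b * conj_root \<beta>" by (rule Z_cases)
  have "(x - cj x)\<^sup>2 = (of_int b)\<^sup>2 * ((of_int m)\<^sup>2 + 4 * (\<beta>\<^sup>2 - of_int m * \<beta>))"
    unfolding ab(2) unfolding ab(1) me(3) by (simp add: algebra_simps power2_eq_square)
  also have "\<dots> = of_int (b\<^sup>2 * (m\<^sup>2 + 4 * c))" by (simp add: me(1))
  finally show thesis using that ab(1) me(2) by blast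
qed

text \<open>The norms of \<open>s\<close> and \<open>1 - s\<close> determine the trace, hence the
  quadratic equation of \<open>s\<close>. Signs leave the norms 1, 2 for \<open>s\<close> and -1, -2
  for \<open>1 - s\<close>, with discriminants 5, 12, 8 and 17.\<close>

lemma forcing_positive_cases:
  assumes s: "s \<in> Z" "0 < s" "0 < cj s" "cj s < 1" "model_set_forcing \<beta> s"
  shows "s = 2 + sqrt 3 \<or> 1 - s \<in> {- (1 + sqrt 5) / 2, - 1 - sqrt 2}"
proof -
  have prod: "0 < s * cj s" using s by simp
  then have N: "s * cj s = 1 \<or> s * cj s = 2" using forcing_norm[OF s(1,3-5)] by auto
  have "s > 1"
  proof (rule ccontr)
    assume "\<not> s > 1"
    then have "s * cj s \<le> 1 * cj s" using s by (intro mult_right_mono) auto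
    then show False using N s(4) by linarith
  qed
  then have "(1 - s) * (1 - cj s) < 0" using s by (simp add: mult_neg_pos)
  moreover have "\<bar>(1 - s) * (1 - cj s)\<bar> = 1 \<or> \<bar>(1 - s) * (1 - cj s)\<bar> = 2"
    using forcing_norm[of "1 - s"] s by (simp add: model_set_forcing_swap)
  ultimately have M: "(1 - s) * (1 - cj s) = - 1 \<or> (1 - s) * (1 - cj s) = - 2" by auto
  have pos: "s - cj s > 0" using \<open>s > 1\<close> s by simp
  define T where "T = s + cj s"
  have T: "T = 1 + s * cj s - (1 - s) * (1 - cj s)"
    by (simp add: T_def algebra_simps)
  have sq: "(s - cj s)\<^sup>2 = T\<^sup>2 - 4 * (s * cj s)"
    by (simp add: T_def power2_eq_square algebra_simps)
  have s_eq: "s = (T + (s - cj s)) / 2" by (simp add: T_def)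
  have root: "s - cj s = sqrt d" if "(s - cj s)\<^sup>2 = d" for d
    using pos that by (simp add: real_sqrt_unique)
  from N M consider "s * cj s = 1" "T = 3" | "s * cj s = 1" "T = 4"
    | "s * cj s = 2" "T = 4" | "s * cj s = 2" "T = 5"
    using T by auto
  then show ?thesis
  proof cases
    case 1
    then have "s - cj s = sqrt 5" using sq by (intro root) simp
    then show ?thesis using s_eq 1 by (simp add: field_simps)
  next
    case 2
    then have "s - cj s = sqrt (2\<^sup>2 * 3)" using sq by (intro root) simp
    then have "s - cj s = 2 * sqrt 3" unfolding real_sqrt_mult by simp
    then show ?thesis using s_eq 2 by simp
  next
    case 3
    then have "s - cj s = sqrt (2\<^sup>2 * 2)" using sq by (intro root) simp
    then have "s - cj s = 2 * sqrt 2" unfolding real_sqrt_mult by simp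
    then show ?thesis using s_eq 3 by simp
  next
    case 4
    \<comment> \<open>As 17 is square-free, \<open>b\<^sup>2 = 1\<close>, so 13 or 21 would have to
      be a square.\<close>
    obtain b m c :: int where *: "\<bar>c\<bar> = 1" "(s - cj s)\<^sup>2 = of_int (b\<^sup>2 * (m\<^sup>2 + 4 * c))"
      using discriminant[OF s(1)] by metis
    have "real_of_int (b\<^sup>2 * (m\<^sup>2 + 4 * c)) = of_int 17" using 4 sq *(2) by simp
    then have eq: "b\<^sup>2 * (m\<^sup>2 + 4 * c) = 17" by (simp only: of_int_eq_iff)
    then have dvd: "b\<^sup>2 dvd 17" by (metis dvd_triv_left)
    from zdvd_imp_le[OF this] have "b\<^sup>2 \<le> 17" by simp
    then have "b\<^sup>2 = 1" using dvd small_squares[of b] by auto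
    then have "m\<^sup>2 + 4 * c = 17" using eq by simp
    moreover have "c = 1 \<or> c = -1" using *(1) by auto
    ultimately have "m\<^sup>2 = 13 \<or> m\<^sup>2 = 21" by auto
    then have False using small_squares[of m] by auto
    then show ?thesis ..
  qed
qed

subsection \<open>The three exceptional parameters\<close>

text \<open>On conjugates, \<open>s * y + (1 - s) * b\<close> contracts \<open>y\<close> towards
  \<open>b\<close> with ratio \<open>cj s\<close>, and preimages stay in \<open>Z\<close> because
  \<open>s\<close> is a unit. The bound on \<open>L\<close> keeps the conjugates of preimages of
  elements beyond \<open>L\<close> nonnegative, so the gap to \<open>cj b\<close> shrinks
  geometrically.\<close>

lemma strip_extend:
  assumes s: "s \<in> Z" "\<bar>s * cj s\<bar> = 1" "0 < cj s" "cj s < 1"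
    and \<Lambda>: "s_convex s \<Lambda>" "Sigma_set \<beta> {0..L} \<subseteq> \<Lambda>"
    and b: "b \<in> \<Lambda>" "b \<in> Z" "(1 - cj s) * cj b \<le> L"
  shows "Sigma_set \<beta> {0..cj b} \<subseteq> \<Lambda>"
proof -
  obtain u where u: "u \<in> Z" "s * u = 1" using unit_inverse s by blast
  define g where "g = cj b - L"
  have step: "Sigma_set \<beta> {0..cj b - cj s ^ n * g} \<subseteq> \<Lambda>" for n
  proof (induction n)
    case 0
    then show ?case using \<Lambda>(2) by (simp add: g_def)
  next
    case (Suc n)
    show ?case
    proof
      fix x
      assume "x \<in> Sigma_set \<beta> {0..cj b - cj s ^ Suc n * g}"
      then have x: "x \<in> Z" "0 \<le> cj x" "cj x \<le> cj b - cj s * (cj s ^ n * g)"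
        by (simp_all add: mult.assoc)
      show "x \<in> \<Lambda>"
      proof (cases "cj x \<le> L")
        case True
        with x \<Lambda>(2) show ?thesis by auto
      next
        case False
        define y where "y = u * (x - (1 - s) * b)"
        have y: "y \<in> Z" using u x b s by (simp add: y_def)
        have x_eq: "x = s * y + (1 - s) * b"
          using u by (simp add: y_def mult.assoc[symmetric])
        then have cjx: "cj x = cj s * cj y + (1 - cj s) * cj b"
          using y s b by simp
        then have "0 \<le> cj s * cj y" using False b(3) by simp
        then have "0 \<le> cj y" using s(3) by (simp add: zero_le_mult_iff)
        moreover have "cj s * cj y \<le> cj s * (cj b - cj s ^ n * g)"
          using cjx x(3) by (simp add: algebra_simps)
        then have "cj y \<le> cj b - cj s ^ n * g" using s(3) by simp
        ultimately have "y \<in> \<Lambda>" using Suc.IH y by auto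
        then show ?thesis using s_convexD[OF \<Lambda>(1)] b(1) x_eq by blast
      qed
    qed
  qed
  show ?thesis
  proof
    fix x
    assume "x \<in> Sigma_set \<beta> {0..cj b}"
    then have x: "x \<in> Z" "0 \<le> cj x" "cj x \<le> cj b" by auto
    show "x \<in> \<Lambda>"
    \<comment> \<open>The contraction need not reach the end point, but \<open>b\<close> is the only
      element with that conjugate.\<close>
    proof (cases "cj x = cj b")
      case True
      then show ?thesis using cj_eq_iff x b by blast
    next
      case False
      define e where "e = (cj b - cj x) / (\<bar>g\<bar> + 1)"
      have "e > 0" using x False by (simp add: e_def)
      then obtain n where n: "cj s ^ n < e"
        using real_arch_pow_inv s(4) by blast
      have "cj s ^ n * g \<le> cj s ^ n * (\<bar>g\<bar> + 1)" using s by (intro mult_left_mono) auto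
      also have "\<dots> \<le> e * (\<bar>g\<bar> + 1)" using n by (intro mult_right_mono) auto
      also have "\<dots> = cj b - cj x" by (simp add: e_def)
      finally show ?thesis using step[of n] x by auto
    qed
  qed
qed

text \<open>Combining 0 with an element multiplies its conjugate by \<open>1 - cj s\<close>. After
  \<open>n\<close> such steps the conjugate is at most 1 and the unit strip suffices;
  \<open>strip_extend\<close> then climbs back one factor at a time.\<close>

lemma strip_extend_iter:
  assumes s: "s \<in> Z" "\<bar>s * cj s\<bar> = 1" "0 < cj s" "cj s < 1"
    and \<Lambda>: "s_convex s \<Lambda>" "0 \<in> \<Lambda>" "Sigma_set \<beta> {0..1} \<subseteq> \<Lambda>"
    and b: "b \<in> \<Lambda>" "b \<in> Z"
  shows "Sigma_set \<beta> {0..cj b} \<subseteq> \<Lambda>"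
proof -
  have *: "(1 - cj s) ^ n * cj c \<le> 1 \<Longrightarrow> c \<in> \<Lambda> \<Longrightarrow> c \<in> Z \<Longrightarrow>
    Sigma_set \<beta> {0..cj c} \<subseteq> \<Lambda>" for n c
  proof (induction n arbitrary: c)
    case 0
    then have "Sigma_set \<beta> {0..cj c} \<subseteq> Sigma_set \<beta> {0..1}" by auto
    then show ?case using \<Lambda>(3) by blast
  next
    case (Suc n)
    have cj: "cj ((1 - s) * c) = (1 - cj s) * cj c" using s Suc.prems by simp
    have "Sigma_set \<beta> {0..cj ((1 - s) * c)} \<subseteq> \<Lambda>"
    proof (rule Suc.IH)
      show "(1 - cj s) ^ n * cj ((1 - s) * c) \<le> 1"
        unfolding cj using Suc.prems(1) by (simp add: mult_ac)
      show "(1 - s) * c \<in> \<Lambda>" using s_convexD[OF \<Lambda>(1,2) Suc.prems(2)] by simp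
      show "(1 - s) * c \<in> Z" using s Suc.prems by simp
    qed
    then show ?case
      using strip_extend[OF s \<Lambda>(1)] Suc.prems cj by simp
  qed
  define e where "e = 1 / (\<bar>cj b\<bar> + 1)"
  have "e > 0" by (simp add: e_def add_nonneg_pos)
  moreover have "1 - cj s < 1" using s by simp
  ultimately obtain n where n: "(1 - cj s) ^ n < e" using real_arch_pow_inv by blast
  have "(1 - cj s) ^ n * cj b \<le> (1 - cj s) ^ n * (\<bar>cj b\<bar> + 1)"
    using s by (intro mult_left_mono) auto
  also have "\<dots> \<le> e * (\<bar>cj b\<bar> + 1)" using n by (intro mult_right_mono) auto
  also have "\<dots> = 1" by (simp add: e_def)
  finally show ?thesis using * b by blast
qed

text \<open>The window is the convex hull of the conjugates. It is filled by strips reaching from 0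
  up to a conjugate and, by reflection, from a conjugate up to 1.\<close>

lemma forcing_if_unit_strip:
  assumes s: "s \<in> Z" "\<bar>s * cj s\<bar> = 1" "0 < cj s" "cj s < 1"
    and strip: "\<And>\<Lambda>. s_convex s \<Lambda> \<Longrightarrow> 0 \<in> \<Lambda> \<Longrightarrow> 1 \<in> \<Lambda> \<Longrightarrow> Sigma_set \<beta> {0..1} \<subseteq> \<Lambda>"
  shows "model_set_forcing \<beta> s"
  unfolding model_set_forcing_def
proof (intro allI impI)
  fix \<Lambda>
  assume "ud_s_convex \<beta> s \<Lambda>"
  then have \<Lambda>: "\<Lambda> \<subseteq> Z" "0 \<in> \<Lambda>" "1 \<in> \<Lambda>" "s_convex s \<Lambda>" and ud: "uniform_discrete \<Lambda>"
    by (simp_all add: ud_s_convex_def)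
  have up: "x \<in> \<Lambda>" if "x \<in> Z" "0 \<le> cj x" "cj x \<le> cj b" "b \<in> \<Lambda>" for x b
    using strip_extend_iter[OF s \<Lambda>(4,2) strip[OF \<Lambda>(4,2,3)] that(4)] that \<Lambda>(1)
    by (auto simp: subset_iff)
  have down: "x \<in> \<Lambda>" if "x \<in> Z" "cj x \<le> 1" "cj b \<le> cj x" "b \<in> \<Lambda>" for x b
  proof -
    define M where "M = {x. 1 - x \<in> \<Lambda>}"
    have M: "s_convex s M" "0 \<in> M" "1 \<in> M"
      using s_convex_reflect[OF \<Lambda>(4)] \<Lambda> by (simp_all add: M_def)
    have "1 - b \<in> M" "1 - b \<in> Z" "cj (1 - b) = 1 - cj b" "cj (1 - x) = 1 - cj x"
      using that \<Lambda>(1) by (auto simp: M_def)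
    then have "1 - x \<in> M"
      using strip_extend_iter[OF s M(1,2) strip[OF M], of "1 - b"] that by auto
    then show "x \<in> \<Lambda>" by (simp add: M_def)
  qed
  define \<Omega> where "\<Omega> = {t. \<exists>a\<in>\<Lambda>. \<exists>b\<in>\<Lambda>. cj a \<le> t \<and> t \<le> cj b}"
  have "is_interval \<Omega>"
    unfolding is_interval_1 \<Omega>_def by (blast intro: order_trans)
  moreover have "bounded \<Omega>"
  proof -
    obtain e where e: "e > 0" "\<forall>x\<in>\<Lambda>. \<forall>y\<in>\<Lambda>. dist x y < e \<longrightarrow> x = y"
      using ud unfolding uniform_discrete_def by blast
    \<comment> \<open>The elements \<open>w\<close> and \<open>1 - w\<close> are too close to 0 and
      1 to lie in \<Lambda>, so by \<open>up\<close> and \<open>down\<close> their conjugates bound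
      the window.\<close>
    obtain w where w: "w \<in> Z" "0 < w" "w < e" "0 < cj w"
      using small_element[OF e(1)] by blast
    have "dist 0 w < e" "dist 1 (1 - w) < e" using w by (simp_all add: dist_real_def)
    then have w_notin: "w \<notin> \<Lambda>" "1 - w \<notin> \<Lambda>" using e(2) \<Lambda>(2,3) w(2) by fastforce+
    then have "cj b < cj w" if "b \<in> \<Lambda>" for b
      using up[OF w(1) _ _ that] w(4) by fastforce
    moreover have "1 - cj w < cj b" if "b \<in> \<Lambda>" for b
      using down[of "1 - w" b] that w w_notin by fastforce
    ultimately have "\<Omega> \<subseteq> {1 - cj w..cj w}"
      unfolding \<Omega>_def by force
    then show ?thesis using bounded_closed_interval bounded_subset by blast
  qed
  moreover have "\<Lambda> = Sigma_set \<beta> \<Omega>"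
  proof
    show "\<Lambda> \<subseteq> Sigma_set \<beta> \<Omega>" using \<Lambda>(1) by (auto simp: \<Omega>_def)
    show "Sigma_set \<beta> \<Omega> \<subseteq> \<Lambda>"
    proof
      fix x
      assume "x \<in> Sigma_set \<beta> \<Omega>"
      then obtain a b where "x \<in> Z" "a \<in> \<Lambda>" "b \<in> \<Lambda>" "cj a \<le> cj x" "cj x \<le> cj b"
        by (auto simp: \<Omega>_def)
      \<comment> \<open>Every real number is nonnegative or at most 1, so \<open>up\<close> or
        \<open>down\<close> applies.\<close>
      then show "x \<in> \<Lambda>" using up[of x b] down[of x a] by linarith
    qed
  qed
  ultimately show "model_set \<beta> \<Lambda>" unfolding model_set_def by blast
qed

section \<open>Descent in the unit strip\<close>

text \<open>If \<open>cj x\<close> is within \<open>cj s\<close> of 0 or 1, the unit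
  \<open>q = s\<close> can be divided out. Otherwise \<open>q = 1 - s\<close> keeps conjugates in
  the unit interval for both values of \<open>e\<close>, so the residue class of \<open>x\<close>
  may choose \<open>e\<close>.\<close>

lemma strip_predecessor:
  assumes s: "s \<in> Z" "\<bar>s * cj s\<bar> = 1" "0 < cj s" "cj s < 1"
    and t: "t \<in> Z" "2 = (1 - s) * t"
    and gen: "\<And>x. x \<in> Z \<Longrightarrow> \<exists>i j :: int. x = of_int i + of_int j * s"
    and x: "x \<in> Z" "0 \<le> cj x" "cj x \<le> 1"
  obtains q e y where "q = s \<or> q = 1 - s" "e = 0 \<or> e = 1"
    "y \<in> Z" "0 \<le> cj y" "cj y \<le> 1" "x = q * y + (1 - q) * e"
proof -
  obtain u where u: "u \<in> Z" "s * u = 1" using unit_inverse s by blast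
  have su: "s * (u * z) = z" for z using u by (simp add: mult.assoc[symmetric])
  note result = that
  have by_s: thesis if e: "e = 0 \<or> e = 1"
    and le: "(1 - cj s) * e \<le> cj x" "cj x \<le> cj s + (1 - cj s) * e" for e
  proof -
    define y where "y = u * (x - (1 - s) * e)"
    have eZ: "e \<in> Z" "cj e = e" using e by auto
    then have y: "y \<in> Z" using u x s by (simp add: y_def)
    have x_eq: "x = s * y + (1 - s) * e" by (simp add: y_def su)
    then have "cj x = cj s * cj y + (1 - cj s) * e"
      using y s eZ by simp
    then have "0 \<le> cj s * cj y" "cj s * cj y \<le> cj s * 1" using le by auto
    then have "0 \<le> cj y" "cj y \<le> 1"
      using s(3) by (simp_all add: zero_le_mult_iff)
    then show thesis using result[of s e y] e y x_eq by blast
  qed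
  show thesis
  proof (cases "cj x \<le> cj s \<or> 1 - cj s \<le> cj x")
    case True
    then show thesis using by_s[of 0] by_s[of 1] x by auto
  next
    case False
    obtain i j :: int where ij: "x = of_int i + of_int j * s" using gen x by blast
    \<comment> \<open>Since \<open>s\<close> is congruent to 1 modulo \<open>1 - s\<close>, and
      \<open>1 - s\<close> divides 2, the parity of \<open>i + j\<close> gives the class of
      \<open>x\<close>.\<close>
    define k where "k = (i + j) div 2"
    define y where "y = of_int k * t - of_int j"
    have y: "y \<in> Z" using t by (simp add: y_def)
    have "(1 - s) * y = of_int k * ((1 - s) * t) - of_int j * (1 - s)"
      by (simp add: y_def algebra_simps)
    then have sy: "(1 - s) * y = 2 * of_int k - of_int j * (1 - s)"
      using t(2) by simp
    have by_1s: thesis if e: "e = 0 \<or> e = 1"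
      and z: "z \<in> Z" "x = (1 - s) * z + s * e" for e z
    proof -
      have eZ: "e \<in> Z" "cj e = e" using e by auto
      then have eq: "(1 - cj s) * cj z = cj x - cj s * e"
        using z s by simp
      have "cj s < cj x" "cj x < 1 - cj s" using False by auto
      then have "0 \<le> (1 - cj s) * cj z" "(1 - cj s) * cj z \<le> (1 - cj s) * 1"
        unfolding eq using e s(3) by auto
      then have "0 \<le> cj z" "cj z \<le> 1"
        using s(4) by (simp_all add: zero_le_mult_iff)
      then show thesis using result[of "1 - s" e z] e z by simp
    qed
    have "i + j = 2 * k \<or> i + j = 2 * k + 1" unfolding k_def by presburger
    then have "real_of_int i + of_int j = of_int (2 * k) \<or>
        real_of_int i + of_int j = of_int (2 * k + 1)"
      by (metis of_int_add)
    then have "x = (1 - s) * y + s * 0 \<or> x = (1 - s) * (y + 1) + s * 1"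
      using sy ij by (auto simp: algebra_simps)
    then show thesis
      using by_1s[of 0 y] by_1s[of 1 "y + 1"] y by auto
  qed
qed

text \<open>Descent on the distance to 1/2: a predecessor replaces a bound \<open>B\<close> by
  \<open>r * B + (1 + r) / 2\<close>, and \<open>K\<close> lies above the fixed point of this map,
  so every step gains at least \<open>d\<close>.\<close>

lemma unit_strip_subset:
  assumes s: "s \<in> Z" "\<bar>s * cj s\<bar> = 1" "0 < cj s" "cj s < 1"
    and t: "t \<in> Z" "2 = (1 - s) * t"
    and gen: "\<And>x. x \<in> Z \<Longrightarrow> \<exists>i j :: int. x = of_int i + of_int j * s"
    and r: "0 \<le> r" "1 \<le> r * \<bar>s\<bar>" "1 \<le> r * \<bar>1 - s\<bar>" "r * K + (1 + r) / 2 < K" "r < 1"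
    and base: "\<And>x. x \<in> Z \<Longrightarrow> 0 \<le> cj x \<Longrightarrow> cj x \<le> 1 \<Longrightarrow> \<bar>x - 1/2\<bar> \<le> K \<Longrightarrow> x \<in> \<Lambda>"
    and \<Lambda>: "s_convex s \<Lambda>" "0 \<in> \<Lambda>" "1 \<in> \<Lambda>"
  shows "Sigma_set \<beta> {0..1} \<subseteq> \<Lambda>"
proof -
  define d where "d = K - (r * K + (1 + r) / 2)"
  have d: "d > 0" using r(4) by (simp add: d_def)
  have *: "x \<in> Z \<Longrightarrow> 0 \<le> cj x \<Longrightarrow> cj x \<le> 1 \<Longrightarrow>
    \<bar>x - 1/2\<bar> \<le> K + of_nat n * d \<Longrightarrow> x \<in> \<Lambda>" for n x
  proof (induction n arbitrary: x)
    case 0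
    then show ?case using base by simp
  next
    case (Suc n)
    obtain q e y where q: "q = s \<or> q = 1 - s" "e = 0 \<or> e = 1"
      and y: "y \<in> Z" "0 \<le> cj y" "cj y \<le> 1" and x_eq: "x = q * y + (1 - q) * e"
      using strip_predecessor[OF s t gen Suc.prems(1-3)] by metis
    have "1 \<le> r * \<bar>q\<bar>" using q r by auto
    from affine_preimage_contraction[OF x_eq q(2) this r(1)]
    have "\<bar>y - 1/2\<bar> \<le> r * \<bar>x - 1/2\<bar> + (1 + r) / 2" .
    also have "r * \<bar>x - 1/2\<bar> \<le> r * (K + of_nat (Suc n) * d)"
      using Suc.prems(4) r(1) by (intro mult_left_mono) auto
    also have "\<dots> \<le> r * K + of_nat (Suc n) * d"
      using d r(1,5) mult_right_mono[of r 1 "of_nat (Suc n) * d"]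
      by (simp add: distrib_left)
    also have "r * K + of_nat (Suc n) * d + (1 + r) / 2 = K + of_nat n * d"
      by (simp add: d_def field_simps)
    finally have "y \<in> \<Lambda>" using Suc.IH y by simp
    moreover have "e \<in> \<Lambda>" using q(2) \<Lambda> by auto
    ultimately show ?case
      using s_convexD[OF \<Lambda>(1), of y e] s_convexD[OF \<Lambda>(1), of e y] q(1) x_eq
      by (auto simp: add.commute)
  qed
  show ?thesis
  proof
    fix x
    assume "x \<in> Sigma_set \<beta> {0..1}"
    moreover obtain n where "(\<bar>x - 1/2\<bar> - K) / d < of_nat n"
      using reals_Archimedean2 by blast
    then have "\<bar>x - 1/2\<bar> \<le> K + of_nat n * d" using d by (simp add: field_simps)
    ultimately show "x \<in> \<Lambda>" using * by auto
  qed
qed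

section \<open>Verification for the three values\<close>

text \<open>Here \<open>T\<close> and \<open>N\<close> are trace and norm. As 5, 8 and 12 are
  fundamental discriminants, the order generated by \<open>s\<close> is maximal, hence all of
  \<open>Z\<close>; concretely, the coefficient of \<beta> in \<open>s\<close> is
  \<plusminus>1.\<close>

lemma quadratic_integer:
  fixes T N :: int
  assumes "s \<in> Z" "s\<^sup>2 = of_int T * s - of_int N" and D: "T\<^sup>2 - 4 * N \<in> {5, 8, 12}"
  shows "cj s = of_int T - s"
    and "x \<in> Z \<Longrightarrow> \<exists>i j :: int. x = of_int i + of_int j * s"
proof -
  have "cj s * cj s = cj (s * s)" using assms(1) by simp
  also have "s * s = of_int T * s - of_int N" using assms(2) by (simp add: power2_eq_square)
  also have "cj \<dots> = of_int T * cj s - of_int N" using assms(1) by simp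
  finally have cj2: "(cj s)\<^sup>2 = of_int T * cj s - of_int N" by (simp add: power2_eq_square)
  have "cj s \<noteq> s"
  proof
    assume "cj s = s"
    then have "s + s \<in> \<int>" using trace_Ints[OF assms(1)] by simp
    then obtain k :: int where k: "2 * s = of_int k" by (auto elim: Ints_cases)
    have "(of_int k - of_int T)\<^sup>2 = 4 * s\<^sup>2 - 4 * of_int T * s + (of_int T)\<^sup>2"
      unfolding k[symmetric] by (simp add: power2_eq_square algebra_simps)
    also have "\<dots> = (of_int T)\<^sup>2 - 4 * of_int N" unfolding assms(2) by simp
    finally have "real_of_int ((k - T)\<^sup>2) = of_int (T\<^sup>2 - 4 * N)" by simp
    then have "(k - T)\<^sup>2 \<in> {5, 8, 12}" using D by (simp only: of_int_eq_iff)
    then show False using small_squares[of "k - T"] by auto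
  qed
  then show cj: "cj s = of_int T - s"
    using other_root[of s "of_int T" "- of_int N" "cj s"] assms(2) cj2 by simp
  obtain a b m c :: int where abmc: "s = of_int a + of_int b * \<beta>" "\<bar>c\<bar> = 1"
    "(s - cj s)\<^sup>2 = of_int (b\<^sup>2 * (m\<^sup>2 + 4 * c))"
    using discriminant[OF assms(1)] by blast
  have "(s - cj s)\<^sup>2 = of_int (T\<^sup>2) + 4 * (s\<^sup>2 - of_int T * s)"
    unfolding cj by (simp add: power2_eq_square algebra_simps)
  also have "\<dots> = of_int (T\<^sup>2 - 4 * N)" unfolding assms(2) by simp
  finally have "b\<^sup>2 * (m\<^sup>2 + 4 * c) = T\<^sup>2 - 4 * N" using abmc(3) by (simp only: of_int_eq_iff)
  then have eq: "b\<^sup>2 * (m\<^sup>2 + 4 * c) \<in> {5, 8, 12}" using D by simp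
  show "\<exists>i j :: int. x = of_int i + of_int j * s" if "x \<in> Z"
  proof -
    from that obtain i j :: int where ij: "x = of_int i + of_int j * \<beta>"
      unfolding Z_adj_def by blast
    have "b\<^sup>2 dvd 5 \<or> b\<^sup>2 dvd 8 \<or> b\<^sup>2 dvd 12"
      using eq by (metis dvd_triv_left insertE singletonD)
    moreover from this have "b\<^sup>2 \<le> 12" by (auto dest: zdvd_imp_le)
    ultimately have b: "b\<^sup>2 = 1 \<or> b\<^sup>2 = 4" using small_squares[of b] by auto
    have "b\<^sup>2 \<noteq> 4"
    proof
      assume "b\<^sup>2 = 4"
      then have "m\<^sup>2 + 4 * c = 2 \<or> m\<^sup>2 + 4 * c = 3" using eq by auto
      then have "m\<^sup>2 \<in> {-2, 6, -1, 7}" using abmc(2) by auto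
      then show False using small_squares[of m] by auto
    qed
    with b have "b\<^sup>2 = 1" by blast
    then have "real_of_int (b * b) = 1" by (simp add: power2_eq_square)
    then have "x = of_int (i - j * b * a) + of_int (j * b) * s"
      using abmc(1) ij by (simp add: algebra_simps)
    then show ?thesis by blast
  qed
qed

text \<open>Reduces forcing to numerical checks. The condition on \<open>k\<close> says that the
  norm of \<open>1 - s\<close> divides 2, and \<open>base\<close> lists the elements where the
  descent ends, using \<open>j * (2 * s - T) = x - cj x\<close>.\<close>

lemma exceptional_forcing:
  fixes T N k :: int
  assumes s: "s \<in> Z" "s\<^sup>2 = of_int T * s - of_int N" "\<bar>N\<bar> = 1" "T\<^sup>2 - 4 * N \<in> {5, 8, 12}"
    and T: "0 < of_int T - s" "of_int T - s < 1"
    and k: "k * (1 - T + N) = 2"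
    and r: "0 \<le> r" "1 \<le> r * \<bar>s\<bar>" "1 \<le> r * \<bar>1 - s\<bar>" "r * K + (1 + r) / 2 < K" "r < 1"
    and base: "\<And>i j :: int. \<bar>of_int j * (2 * s - of_int T)\<bar> \<le> K + 1/2 \<Longrightarrow>
      0 \<le> of_int i + of_int j * (of_int T - s) \<Longrightarrow> of_int i + of_int j * (of_int T - s) \<le> 1 \<Longrightarrow>
      of_int i + of_int j * s \<in> {0, 1, s, 1 - s}"
  shows "(\<exists>\<Lambda>. ud_s_convex \<beta> s \<Lambda>) \<and> model_set_forcing \<beta> s"
proof
  note cj = quadratic_integer(1)[OF s(1,2,4)] and gen = quadratic_integer(2)[OF s(1,2,4)]
  have cj01: "0 < cj s" "cj s < 1" using T cj by auto
  have "s * cj s = of_int T * s - s\<^sup>2" unfolding cj by (simp add: power2_eq_square algebra_simps)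
  then have sN: "s * cj s = of_int N" using s(2) by simp
  then have norm: "\<bar>s * cj s\<bar> = 1" using s(3) by (metis of_int_1 of_int_abs)
  show "\<exists>\<Lambda>. ud_s_convex \<beta> s \<Lambda>" using unit_strip_ud_s_convex[OF s(1) cj01] by blast
  \<comment> \<open>The conjugate of \<open>1 - s\<close> completes it to its norm, and
    \<open>k\<close> completes the norm to 2.\<close>
  define t where "t = of_int k * (1 - cj s)"
  have t: "t \<in> Z" using s by (simp add: t_def)
  have "(1 - s) * t = of_int k * (1 - (s + cj s) + s * cj s)"
    by (simp add: t_def algebra_simps)
  also have "\<dots> = of_int (k * (1 - T + N))" unfolding sN unfolding cj by simp
  finally have t2: "2 = (1 - s) * t" using k by simp
  show "model_set_forcing \<beta> s"
  proof (rule forcing_if_unit_strip[OF s(1) norm cj01])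
    fix \<Lambda>
    assume \<Lambda>: "s_convex s \<Lambda>" "0 \<in> \<Lambda>" "1 \<in> \<Lambda>"
    have small: "{0, 1, s, 1 - s} \<subseteq> \<Lambda>"
      using s_convexD[OF \<Lambda>(1), of 1 0] s_convexD[OF \<Lambda>(1), of 0 1] \<Lambda> by simp
    show "Sigma_set \<beta> {0..1} \<subseteq> \<Lambda>"
    proof (rule unit_strip_subset[OF s(1) norm cj01 t t2 gen r _ \<Lambda>])
      fix x
      assume x: "x \<in> Z" "0 \<le> cj x" "cj x \<le> 1" "\<bar>x - 1/2\<bar> \<le> K"
      obtain i j :: int where ij: "x = of_int i + of_int j * s" using gen x by blast
      then have cjx: "cj x = of_int i + of_int j * (of_int T - s)" using s(1) cj by simp
      have "of_int j * (2 * s - of_int T) = (x - 1/2) - (cj x - 1/2)"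
        unfolding cjx unfolding ij by (simp add: algebra_simps)
      then have "\<bar>of_int j * (2 * s - of_int T)\<bar> \<le> K + 1/2" using x by linarith
      then have "x \<in> {0, 1, s, 1 - s}" using base[of j i] x cjx ij by simp
      then show "x \<in> \<Lambda>" using small by blast
    qed
  qed
qed

text \<open>If \<open>s\<close>, \<open>1 - s\<close> and \<open>s - cj s\<close> are large enough,
  the descent ends at 0 or 1.\<close>

lemma exceptional_forcing_sparse:
  fixes T N k :: int
  assumes s: "s \<in> Z" "s\<^sup>2 = of_int T * s - of_int N" "\<bar>N\<bar> = 1" "T\<^sup>2 - 4 * N \<in> {5, 8, 12}"
    and T: "0 < of_int T - s" "of_int T - s < 1"
    and k: "k * (1 - T + N) = 2"
    and large: "241/100 \<le> \<bar>s\<bar>" "241/100 \<le> \<bar>1 - s\<bar>" "2 \<le> \<bar>2 * s - of_int T\<bar>"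
  shows "(\<exists>\<Lambda>. ud_s_convex \<beta> s \<Lambda>) \<and> model_set_forcing \<beta> s"
\<comment> \<open>The ratio 42/100 exceeds 100/241, and 13/10 exceeds the fixed point 142/116, while
  13/10 + 1/2 < 2 forces \<open>j = 0\<close>.\<close>
proof (rule exceptional_forcing[OF s T k, of "42/100" "13/10"])
  fix i j :: int
  assume le: "\<bar>of_int j * (2 * s - of_int T)\<bar> \<le> 13/10 + 1/2"
    and x: "0 \<le> of_int i + of_int j * (of_int T - s)"
      "of_int i + of_int j * (of_int T - s) \<le> 1"
  have "j = 0"
  proof (rule ccontr)
    assume "j \<noteq> 0"
    then have "1 \<le> \<bar>real_of_int j\<bar>" by linarith
    then have "1 * 2 \<le> \<bar>real_of_int j\<bar> * \<bar>2 * s - of_int T\<bar>"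
      using large(3) by (intro mult_mono) auto
    then show False using le by (simp add: abs_mult)
  qed
  then show "of_int i + of_int j * s \<in> {0, 1, s, 1 - s}" using x by auto
qed (use large in auto)

lemma exceptional_parameters:
  assumes "s \<in> Z" "s \<in> {- (1 + sqrt 5) / 2, - 1 - sqrt 2, 2 + sqrt 3}"
  shows "(\<exists>\<Lambda>. ud_s_convex \<beta> s \<Lambda>) \<and> model_set_forcing \<beta> s"
proof -
  consider "s = - (1 + sqrt 5) / 2" | "s = - 1 - sqrt 2" | "s = 2 + sqrt 3"
    using assms(2) by blast
  then show ?thesis
  proof cases
    case 1
    have b: "2236/1000 \<le> sqrt 5" "sqrt 5 \<le> 2237/1000"
      by (rule real_le_rsqrt real_le_lsqrt; simp add: power2_eq_square)+
    then have s_bounds: "- 1619/1000 \<le> s" "s \<le> - 1618/1000"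
      unfolding 1 by (simp_all add: field_simps)
    \<comment> \<open>Here \<open>1 - s\<close> has norm 1, so \<open>k = 2\<close>. The ratio
      62/100 exceeds 1/\<bar>s\<bar>, about 0.618, and 22/10 exceeds the fixed point 162/76.\<close>
    show ?thesis
    proof (rule exceptional_forcing[of s "-1" "-1" 2 "62/100" "22/10"])
      show "s\<^sup>2 = of_int (- 1) * s - of_int (- 1)"
        unfolding 1 by (simp add: power2_eq_square field_simps)
      fix i j :: int
      assume le: "\<bar>of_int j * (2 * s - of_int (-1))\<bar> \<le> 22/10 + 1/2"
        and x: "0 \<le> of_int i + of_int j * (of_int (-1) - s)"
          "of_int i + of_int j * (of_int (-1) - s) \<le> 1"
      have "2 * s - of_int (-1) = - sqrt 5" unfolding 1 by (simp add: field_simps)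
      \<comment> \<open>This conjugate is about 0.618, so each of \<open>j = 1\<close> and
        \<open>j = -1\<close> admits just one \<open>i\<close>.\<close>
      have conj: "of_int (-1) - s = (sqrt 5 - 1) / 2" unfolding 1 by (simp add: field_simps)
      have "\<bar>real_of_int j\<bar> * sqrt 5 \<le> 27/10"
        using le \<open>2 * s - of_int (-1) = - sqrt 5\<close> by (simp add: abs_mult)
      moreover have "\<bar>real_of_int j\<bar> * 2 \<le> \<bar>real_of_int j\<bar> * sqrt 5"
        using b by (intro mult_left_mono) auto
      ultimately have "\<bar>real_of_int j\<bar> < 2" by linarith
      then have "j = 0 \<or> j = 1 \<or> j = -1" by linarith
      then show "of_int i + of_int j * s \<in> {0, 1, s, 1 - s}"
      proof (elim disjE)
        assume "j = 0"
        then show ?thesis using x by auto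
      next
        assume j: "j = 1"
        then have "0 \<le> of_int i + (sqrt 5 - 1) / 2" "of_int i + (sqrt 5 - 1) / 2 \<le> 1"
          using x[unfolded conj] by (simp_all add: field_simps)
        then have "real_of_int i < 1" "real_of_int i > -1" using b by (simp_all add: field_simps)
        then have "i = 0" by linarith
        then show ?thesis using j by simp
      next
        assume j: "j = -1"
        then have "0 \<le> of_int i - (sqrt 5 - 1) / 2" "of_int i - (sqrt 5 - 1) / 2 \<le> 1"
          using x[unfolded conj] by (simp_all add: field_simps)
        then have "real_of_int i < 2" "real_of_int i > 0" using b by (simp_all add: field_simps)
        then have "i = 1" by linarith
        then show ?thesis using j by simp
      qed
    qed (use assms(1) s_bounds in auto)
  next
    case 2
    have "1414/1000 \<le> sqrt 2" "sqrt 2 \<le> 1415/1000"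
      by (rule real_le_rsqrt real_le_lsqrt; simp add: power2_eq_square)+
    then have s_bounds: "s \<le> - 241/100" "- 242/100 \<le> s" unfolding 2 by simp_all
    \<comment> \<open>The norm of \<open>1 - s\<close> is 2, so \<open>k = 1\<close>.\<close>
    have "s\<^sup>2 = of_int (- 2) * s - of_int (- 1)"
      unfolding 2 by (simp add: power2_eq_square algebra_simps)
    then show ?thesis
      by (rule exceptional_forcing_sparse[OF assms(1), of _ _ 1]) (use s_bounds in auto)
  next
    case 3
    have "1732/1000 \<le> sqrt 3" "sqrt 3 \<le> 1733/1000"
      by (rule real_le_rsqrt real_le_lsqrt; simp add: power2_eq_square)+
    then have s_bounds: "s \<le> 374/100" "373/100 \<le> s" unfolding 3 by simp_all
    \<comment> \<open>The norm of \<open>1 - s\<close> is -2, so \<open>k = -1\<close>.\<close>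
    have "s\<^sup>2 = of_int 4 * s - of_int 1"
      unfolding 3 by (simp add: power2_eq_square algebra_simps)
    then show ?thesis
      by (rule exceptional_forcing_sparse[OF assms(1), of _ _ "- 1"]) (use s_bounds in auto)
  qed
qed

lemma forcing_parameters:
  assumes "s \<in> Z" "ud_s_convex \<beta> s \<Lambda>" "model_set_forcing \<beta> s"
  shows "s \<in> {- (1 + sqrt 5) / 2, - 1 - sqrt 2, 2 + sqrt 3} \<or>
    1 - s \<in> {- (1 + sqrt 5) / 2, - 1 - sqrt 2, 2 + sqrt 3}"
proof -
  note cj01 = forcing_cj_in_unit_interval[OF assms]
  have "s \<noteq> 0" using cj01(1) by auto
  then consider "s > 0" | "1 - s > 0" by linarith
  then show ?thesis
  proof cases
    case 1
    then show ?thesis using forcing_positive_cases[of s] cj01 assms by auto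
  next
    case 2
    then show ?thesis
      using forcing_positive_cases[of "1 - s"] cj01 assms by (auto simp: model_set_forcing_swap)
  qed
qed

end

theorem theorem4p1:
  fixes \<beta> s :: real
  assumes "quadratic_unitary_Pisot \<beta>"
    and "s \<in> Z_adj \<beta>"
  shows "((\<exists>\<Lambda>. ud_s_convex \<beta> s \<Lambda>) \<and> model_set_forcing \<beta> s) \<longleftrightarrow>
    (s \<in> {- (1 + sqrt 5) / 2, - 1 - sqrt 2, 2 + sqrt 3} \<or>
     1 - s \<in> {- (1 + sqrt 5) / 2, - 1 - sqrt 2, 2 + sqrt 3})"
proof -
  interpret quadratic_Pisot \<beta> by unfold_locales (rule assms(1))
  have "1 - s \<in> Z_adj \<beta>" using assms(2) by simp
  then show ?thesis
    using exceptional_parameters[of s] exceptional_parameters[of "1 - s"] assms(2)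
      forcing_parameters[of s] ud_s_convex_swap model_set_forcing_swap by blast
qed

end
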